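(* Let $G$ be a graph with $\chi(G) = 0$. Then for every natural number $n$ there exists a continuous map $s_n : \mathrm{Conf}_n(G) \to \mathrm{Conf}_{n+1}(G)$ with $\phi_{n+1} \circ s_n = \mathrm{id}_{\mathrm{Conf}_n(G)}$, where $\phi_{n+1} : \mathrm{Conf}_{n+1}(G) \to \mathrm{Conf}_n(G)$ is the forgetting map $(x_1, \ldots, x_{n+1}) \mapsto (x_1, \ldots, x_n)$. That is, a section $s_n$ exists for all $n$.
   Context: A graph is a finite connected 1-dimensional cell complex; $\chi(G)$ denotes its Euler characteristic. The $n$-th ordered configuration space is $\mathrm{Conf}_n(G) = \{(x_1, \ldots, x_n) \in G^n : x_i \neq x_j \text{ for } i \neq j\}$ with the subspace topology from $G^n$. *)

theory Defs
  imports "HOL-Analysis.Analysis"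
begin

text \<open>A cell structure of dimension one on the space \<open>X\<close>: the 0-cells are the points of \<open>V\<close>, the
  1-cells are indexed by \<open>E\<close>, and \<open>\<Phi> e\<close> is the characteristic map of the 1-cell \<open>e\<close>, defined on the
  closed 1-disc \<open>[0,1]\<close>. Loops and multiple edges are allowed. As there are only finitely many
  cells and \<open>X\<close> is Hausdorff, closure-finiteness, the weak topology, and the fact that each \<open>\<Phi> e\<close> is a
  homeomorphism from \<open>(0,1)\<close> onto its image need not be required separately.
  Since \<open>E\<close> is nonempty, so is \<open>X\<close> (\<^const>\<open>connected_space\<close> alone would admit the empty space).\<close>

definition graph_complex ::
  "'a topology \<Rightarrow> 'a set \<Rightarrow> 'e set \<Rightarrow> ('e \<Rightarrow> real \<Rightarrow> 'a) \<Rightarrow> bool" where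
  "graph_complex X V E \<Phi> \<longleftrightarrow>
     Hausdorff_space X \<and> connected_space X \<and>
     finite V \<and> finite E \<and> E \<noteq> {} \<and>
     (\<forall>e\<in>E. continuous_map (top_of_set {0..1}) X (\<Phi> e) \<and>
            inj_on (\<Phi> e) {0<..<1} \<and>
            \<Phi> e ` {0, 1} \<subseteq> V \<and>
            \<Phi> e ` {0<..<1} \<inter> V = {}) \<and>
     disjoint_family_on (\<lambda>e. \<Phi> e ` {0<..<1}) E \<and>
     topspace X = V \<union> (\<Union>e\<in>E. \<Phi> e ` {0<..<1})"

definition euler_char :: "'a set \<Rightarrow> 'e set \<Rightarrow> int" where
  "euler_char V E = int (card V) - int (card E)"

text \<open>Points of \<open>X\<^sup>n\<close> are functions on \<open>{..<n}\<close>, extensional as elements of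
  \<^const>\<open>product_topology\<close>; coordinates are thus numbered from 0.\<close>

definition conf_space :: "nat \<Rightarrow> 'a topology \<Rightarrow> (nat \<Rightarrow> 'a) topology" where
  "conf_space n X =
     subtopology (product_topology (\<lambda>_. X) {..<n})
       {x. \<forall>i<n. \<forall>j<n. i \<noteq> j \<longrightarrow> x i \<noteq> x j}"

text \<open>The map from configurations of \<open>n + 1\<close> points to configurations of \<open>n\<close> points that forgets
  the last point.\<close>

definition forget_last :: "nat \<Rightarrow> (nat \<Rightarrow> 'a) \<Rightarrow> (nat \<Rightarrow> 'a)" where
  "forget_last n x = restrict x {..<n}"

end

theory Submission imports Defs begin

text \<open>A connected graph with as many vertices as edges can be oriented so that every vertex has
  exactly one outgoing edge. Moving with unit speed in the direction of the edges is then a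
  well-defined continuous semi-flow on the graph: at each vertex there is a unique way to continue.
  The semi-flow has no fixed points for times in \<open>(0, 1)\<close>. The new point is obtained by letting the
  first point of the configuration flow for a short positive time, bounded in terms of the
  distances from the first point to the others.\<close>

section \<open>Orientations of connected graphs\<close>

text \<open>\<open>T\<close> is a spanning tree, and \<open>p\<close> sends each vertex other than
  the root \<open>r\<close> to the first edge on its tree path to \<open>r\<close>. The assumption
  \<open>cut\<close> is connectedness in combinatorial form.\<close>

lemma spanning_tree_orientation:
  fixes V :: "'a set" and a b :: "'e \<Rightarrow> 'a"
  assumes "finite V" "V \<noteq> {}"
    and cut: "\<And>S. S \<subset> V \<Longrightarrow> S \<noteq> {} \<Longrightarrow>
      \<exists>e\<in>E. a e \<in> S \<and> b e \<in> V - S \<or> b e \<in> S \<and> a e \<in> V - S"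
  obtains T where "T \<subseteq> E" "finite T" "Suc (card T) = card V"
    "\<And>r. r \<in> V \<Longrightarrow> \<exists>p. inj_on p (V - {r}) \<and> p ` (V - {r}) \<subseteq> T \<and>
       (\<forall>v\<in>V - {r}. v = a (p v) \<or> v = b (p v))"
proof -
  \<comment> \<open>Grow a subtree one edge at a time. Keeping an orientation towards every root \<open>r\<close> allows
      re-rooting at the newly attached vertex.\<close>
  define P where "P S T \<longleftrightarrow> T \<subseteq> E \<and> finite T \<and> Suc (card T) = card S \<and>
      (\<forall>e\<in>T. a e \<in> S \<and> b e \<in> S) \<and>
      (\<forall>r\<in>S. \<exists>p. inj_on p (S - {r}) \<and> p ` (S - {r}) \<subseteq> T \<and>
        (\<forall>v\<in>S - {r}. v = a (p v) \<or> v = b (p v)))" for S T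
  have grow: "\<exists>S T. S \<subseteq> V \<and> card S = Suc k \<and> P S T" if "Suc k \<le> card V" for k
    using that
  proof (induction k)
    case 0
    obtain v where "v \<in> V" using assms by blast
    then have "{v} \<subseteq> V \<and> card {v} = Suc 0 \<and> P {v} {}"
      unfolding P_def by auto
    then show ?case by blast
  next
    case (Suc k)
    then obtain S T where ST: "S \<subseteq> V" "card S = Suc k" "P S T" by auto
    have finS: "finite S" using ST assms(1) finite_subset by blast
    have "S \<subset> V" using ST Suc.prems by auto
    moreover have "S \<noteq> {}" using ST by auto
    ultimately obtain e where e: "e \<in> E"
      "a e \<in> S \<and> b e \<in> V - S \<or> b e \<in> S \<and> a e \<in> V - S"
      using cut by meson
    then obtain s w where sw: "s \<in> S" "w \<in> V - S" "{a e, b e} = {s, w}"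
      by blast
    have "e \<notin> T" using ST(3) e(2) unfolding P_def by blast
    have root: "\<exists>p. inj_on p (S - {r}) \<and> p ` (S - {r}) \<subseteq> T \<and>
        (\<forall>v\<in>S - {r}. v = a (p v) \<or> v = b (p v))" if "r \<in> S" for r
      using ST(3) that unfolding P_def by blast
    have ext: "\<exists>p. inj_on p (insert w S - {r}) \<and> p ` (insert w S - {r}) \<subseteq> insert e T \<and>
        (\<forall>v\<in>insert w S - {r}. v = a (p v) \<or> v = b (p v))" if r: "r \<in> insert w S" for r
    proof (cases "r = w")
      case True
      \<comment> \<open>Re-rooting at \<open>w\<close>: the old assignment towards \<open>s\<close>
        is kept, and \<open>s\<close> takes the new edge \<open>e\<close>, which leads to
        \<open>w\<close>.\<close>
      obtain p where p: "inj_on p (S - {s})" "p ` (S - {s}) \<subseteq> T"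
        "\<forall>v\<in>S - {s}. v = a (p v) \<or> v = b (p v)"
        using root[OF sw(1)] by blast
      have "insert w S - {r} = insert s (S - {s})" using True sw by auto
      moreover have "inj_on (p(s := e)) (insert s (S - {s}))"
        using p \<open>e \<notin> T\<close> by (auto simp: inj_on_def)
      ultimately show ?thesis using p sw(3)
        by (intro exI[of _ "p(s := e)"]) (auto simp: doubleton_eq_iff)
    next
      case False
      then obtain p where p: "inj_on p (S - {r})" "p ` (S - {r}) \<subseteq> T"
        "\<forall>v\<in>S - {r}. v = a (p v) \<or> v = b (p v)"
        using root r by blast
      have "insert w S - {r} = insert w (S - {r})" using False by auto
      moreover have "inj_on (p(w := e)) (insert w (S - {r}))"
        using p \<open>e \<notin> T\<close> sw by (auto simp: inj_on_def)
      ultimately show ?thesis using p sw(2,3)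
        by (intro exI[of _ "p(w := e)"]) (auto simp: doubleton_eq_iff)
    qed
    have "a e \<in> insert w S" "b e \<in> insert w S" using sw by (auto simp: doubleton_eq_iff)
    then have "P (insert w S) (insert e T)"
      using ST(3) ext e(1) \<open>e \<notin> T\<close> sw(2) finS unfolding P_def by simp
    moreover have "card (insert w S) = Suc (Suc k)" "insert w S \<subseteq> V"
      using ST sw finS by auto
    ultimately show ?case by blast
  qed
  obtain k where "card V = Suc k"
    using assms by (metis card_0_eq not0_implies_Suc)
  then obtain S T where "S \<subseteq> V" "card S = card V" "P S T"
    using grow[of k] by auto
  then have "P V T" using assms(1) card_subset_eq by blast
  then show ?thesis using that unfolding P_def by blast
qed

text \<open>A spanning tree has one edge fewer than \<open>E\<close>, so some edge \<open>e\<close>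
  lies outside it. Orienting the tree towards an end of \<open>e\<close> leaves only that root
  unassigned, and the root takes \<open>e\<close>. The resulting injection is onto because
  \<open>V\<close> and \<open>E\<close> have equal size.\<close>

lemma outgoing_edge_bijection:
  fixes V :: "'a set" and E :: "'e set" and a b :: "'e \<Rightarrow> 'a"
  assumes "finite V" "V \<noteq> {}" "card V = card E"
    and cut: "\<And>S. S \<subset> V \<Longrightarrow> S \<noteq> {} \<Longrightarrow>
      \<exists>e\<in>E. a e \<in> S \<and> b e \<in> V - S \<or> b e \<in> S \<and> a e \<in> V - S"
    and "\<And>e. e \<in> E \<Longrightarrow> a e \<in> V"
  obtains \<sigma> where "bij_betw \<sigma> V E" "\<And>v. v \<in> V \<Longrightarrow> v = a (\<sigma> v) \<or> v = b (\<sigma> v)"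
proof -
  have finE: "finite E" using assms(1-3) by (metis card_0_eq card.infinite)
  obtain T where T: "T \<subseteq> E" "finite T" "Suc (card T) = card V"
    "\<And>r. r \<in> V \<Longrightarrow> \<exists>p. inj_on p (V - {r}) \<and> p ` (V - {r}) \<subseteq> T \<and>
       (\<forall>v\<in>V - {r}. v = a (p v) \<or> v = b (p v))"
    using spanning_tree_orientation[OF assms(1,2) cut] by metis
  have "T \<noteq> E" using T assms(3) by auto
  then obtain e where e: "e \<in> E" "e \<notin> T" using T by blast
  define r where "r = a e"
  have "r \<in> V" using assms(5) e r_def by blast
  then obtain p where p: "inj_on p (V - {r})" "p ` (V - {r}) \<subseteq> T"
    "\<forall>v\<in>V - {r}. v = a (p v) \<or> v = b (p v)"
    using T(4) by blast
  have inj: "inj_on (p(r := e)) V"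
    using p e by (auto simp: inj_on_def)
  moreover have "p(r := e) ` V \<subseteq> E"
    using p(2) e T(1) by auto
  ultimately have "bij_betw (p(r := e)) V E"
    using finE assms(3) by (metis bij_betw_def card_image card_subset_eq)
  moreover have "v = a ((p(r := e)) v) \<or> v = b ((p(r := e)) v)" if "v \<in> V" for v
    using p(3) that r_def by auto
  ultimately show ?thesis using that by blast
qed

section \<open>Gluing along finite compact covers\<close>

text \<open>Continuous maps from compact to Hausdorff spaces are closed, so the preimage of a closed
  set under \<open>f\<close> is a finite union of closed images from the pieces \<open>K i\<close>.
  This reduces continuity on the graph to continuity in edge parameters.\<close>

lemma continuous_map_gluing:
  assumes "finite I"
    and compact: "\<And>i. i \<in> I \<Longrightarrow> compact_space (K i)"
    and g: "\<And>i. i \<in> I \<Longrightarrow> continuous_map (K i) Y (g i)"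
    and "Hausdorff_space Y"
    and cover: "topspace Y \<subseteq> (\<Union>i\<in>I. g i ` topspace (K i))"
    and f: "\<And>i. i \<in> I \<Longrightarrow> continuous_map (K i) Z (\<lambda>k. f (g i k))"
  shows "continuous_map Y Z f"
  unfolding continuous_map_closedin
proof (intro conjI allI impI)
  show "f \<in> topspace Y \<rightarrow> topspace Z"
    using cover f unfolding continuous_map_def by fastforce
next
  fix C assume "closedin Z C"
  have "{x \<in> topspace Y. f x \<in> C} = (\<Union>i\<in>I. g i ` {k \<in> topspace (K i). f (g i k) \<in> C})"
    using cover g unfolding continuous_map_def by fastforce
  moreover have "closedin Y (g i ` {k \<in> topspace (K i). f (g i k) \<in> C})" if "i \<in> I" for i
  proof -
    have "closed_map (K i) Y (g i)"
      using that assms by (intro continuous_imp_closed_map)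
    moreover have "closedin (K i) {k \<in> topspace (K i). f (g i k) \<in> C}"
      using f[OF that] \<open>closedin Z C\<close> unfolding continuous_map_closedin by blast
    ultimately show ?thesis unfolding closed_map_def by blast
  qed
  ultimately show "closedin Y {x \<in> topspace Y. f x \<in> C}"
    using \<open>finite I\<close> by (auto intro!: closedin_Union)
qed

section \<open>Configuration spaces\<close>

lemma topspace_conf_space:
  "topspace (conf_space n X) =
    {x \<in> {..<n} \<rightarrow>\<^sub>E topspace X. \<forall>i<n. \<forall>j<n. i \<noteq> j \<longrightarrow> x i \<noteq> x j}"
  by (auto simp: conf_space_def)

lemma continuous_map_conf_proj:
  "i < n \<Longrightarrow> continuous_map (conf_space n X) X (\<lambda>x. x i)"
  unfolding conf_space_def
  by (intro continuous_map_from_subtopology continuous_map_product_projection) auto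

text \<open>The section appends \<open>f x\<close> as coordinate \<open>n\<close>, the one that
  \<open>forget_last n\<close> drops. What remains is to choose a new point continuously and away
  from the given ones.\<close>

lemma section_if_new_point:
  assumes "continuous_map (conf_space n X) X f"
    and "\<And>x i. x \<in> topspace (conf_space n X) \<Longrightarrow> i < n \<Longrightarrow> f x \<noteq> x i"
  shows "\<exists>s. continuous_map (conf_space n X) (conf_space (Suc n) X) s \<and>
    (\<forall>x\<in>topspace (conf_space n X). (forget_last n \<circ> s) x = x)"
proof (intro exI conjI ballI)
  let ?s = "\<lambda>x. \<lambda>i\<in>{..<Suc n}. if i < n then x i else f x"
  show "continuous_map (conf_space n X) (conf_space (Suc n) X) ?s"
    unfolding conf_space_def[of "Suc n"]
  proof (rule continuous_map_into_subtopology)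
    show "continuous_map (conf_space n X) (product_topology (\<lambda>_. X) {..<Suc n}) ?s"
      unfolding continuous_map_componentwise
    proof (intro conjI ballI)
      fix k assume "k \<in> {..<Suc n}"
      then show "continuous_map (conf_space n X) X (\<lambda>x. ?s x k)"
        using assms(1) continuous_map_conf_proj[of k n] by (cases "k < n") auto
    qed auto
    show "?s \<in> topspace (conf_space n X) \<rightarrow>
        {x. \<forall>i<Suc n. \<forall>j<Suc n. i \<noteq> j \<longrightarrow> x i \<noteq> x j}"
    proof (intro Pi_I CollectI allI impI)
      fix x i j assume x: "x \<in> topspace (conf_space n X)" and ij: "i < Suc n" "j < Suc n" "i \<noteq> j"
      have "x i \<noteq> x j" if "i < n" "j < n" using x ij that by (auto simp: topspace_conf_space)
      then show "?s x i \<noteq> ?s x j"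
        using assms(2)[OF x, of i] assms(2)[OF x, of j] ij by auto
    qed
  qed
  fix x assume "x \<in> topspace (conf_space n X)"
  then show "(forget_last n \<circ> ?s) x = x"
    by (auto simp: topspace_conf_space forget_last_def fun_eq_iff PiE_iff extensional_def)
qed

section \<open>The semi-flow of a functional graph\<close>

abbreviation unit_interval :: "real topology" where
  "unit_interval \<equiv> top_of_set {0..1}"

text \<open>\<open>\<Psi> v\<close> is the one edge that leaves \<open>v\<close>, and
  \<open>h v\<close> is the vertex where it ends. The half-open edges, each with its initial vertex,
  partition the space, so every point has unique coordinates \<open>(v, u)\<close>.\<close>

locale functional_graph =
  fixes X :: "'a topology" and V :: "'v set" and h :: "'v \<Rightarrow> 'v" and \<Psi> :: "'v \<Rightarrow> real \<Rightarrow> 'a"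
  assumes Hausdorff: "Hausdorff_space X"
    and finite_V: "finite V"
    and cont: "v \<in> V \<Longrightarrow> continuous_map unit_interval X (\<Psi> v)"
    and h: "v \<in> V \<Longrightarrow> h v \<in> V"
    and end_eq: "v \<in> V \<Longrightarrow> \<Psi> v 1 = \<Psi> (h v) 0"
    and bij: "bij_betw (\<lambda>(v, u). \<Psi> v u) (V \<times> {0..<1}) (topspace X)"
begin

definition glue :: "('v \<Rightarrow> real \<Rightarrow> 'b) \<Rightarrow> 'a \<Rightarrow> 'b" where
  "glue p x = (case the_inv_into (V \<times> {0..<1}) (\<lambda>(v, u). \<Psi> v u) x of (v, u) \<Rightarrow> p v u)"

text \<open>The end \<open>u = 1\<close> of an edge has coordinates \<open>(h v, 0)\<close>. The
  compatibility condition on \<open>p\<close> extends the defining formula to it, so the formula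
  holds on closed, hence compact, edges.\<close>

lemma glue_eq:
  assumes "v \<in> V" "u \<in> {0..1}" "\<And>v. v \<in> V \<Longrightarrow> p v 1 = p (h v) 0"
  shows "glue p (\<Psi> v u) = p v u"
proof -
  have *: "glue p (\<Psi> w s) = p w s" if "w \<in> V" "s \<in> {0..<1}" for w s
    unfolding glue_def
    using the_inv_into_f_f[of "\<lambda>(v, u). \<Psi> v u" "V \<times> {0..<1}" "(w, s)"] that bij
    by (simp add: bij_betw_def)
  show ?thesis
  proof (cases "u = 1")
    case True
    then show ?thesis using *[of "h v" 0] assms h end_eq by auto
  next
    case False
    then show ?thesis using * assms by auto
  qed
qed

lemma exhaust:
  assumes "x \<in> topspace X"
  obtains v u where "v \<in> V" "0 \<le> u" "u < 1" "x = \<Psi> v u"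
proof -
  have "x \<in> (\<lambda>(v, u). \<Psi> v u) ` (V \<times> {0..<1})"
    using assms bij by (simp add: bij_betw_def)
  then show ?thesis using that by auto
qed

lemma inj:
  assumes "\<Psi> v u = \<Psi> w s" "v \<in> V" "w \<in> V" "u \<in> {0..<1}" "s \<in> {0..<1}"
  shows "v = w \<and> u = s"
  using inj_onD[OF bij_betw_imp_inj_on[OF bij], of "(v, u)" "(w, s)"] assms by simp

lemma \<Psi>_in: "v \<in> V \<Longrightarrow> u \<in> {0..1} \<Longrightarrow> \<Psi> v u \<in> topspace X"
  using continuous_map_image_subset_topspace[OF cont[of v]] by auto

lemma continuous_map_glue:
  assumes "\<And>v. v \<in> V \<Longrightarrow> p v 1 = p (h v) 0"
    and "\<And>v. v \<in> V \<Longrightarrow> continuous_on {0..1} (p v)"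
  shows "continuous_map X euclidean (glue p)"
proof (rule continuous_map_gluing[OF finite_V, where K = "\<lambda>_. unit_interval" and g = \<Psi>])
  show "compact_space unit_interval" by (simp add: compact_space_subtopology)
  show "topspace X \<subseteq> (\<Union>v\<in>V. \<Psi> v ` topspace unit_interval)"
    by (force elim: exhaust)
  fix v assume "v \<in> V"
  have "continuous_map unit_interval euclidean (p v)"
    using assms(2) \<open>v \<in> V\<close> by simp
  then show "continuous_map unit_interval euclidean (\<lambda>u. glue p (\<Psi> v u))"
    by (rule continuous_map_eq) (use glue_eq[of v _ p] \<open>v \<in> V\<close> assms(1) in auto)
qed (auto simp: cont Hausdorff)

text \<open>Motion at unit speed for a time \<open>t\<close> in \<open>[0, 1]\<close>. Edges have
  length one, so the point ends on its own edge or on the next one.\<close>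

definition flow :: "'a \<Rightarrow> real \<Rightarrow> 'a" where
  "flow x t = glue (\<lambda>v u. if u + t \<le> 1 then \<Psi> v (u + t) else \<Psi> (h v) (u + t - 1)) x"

lemma flow_eq:
  assumes "v \<in> V" "u \<in> {0..1}" "t \<in> {0..1}"
  shows "flow (\<Psi> v u) t = (if u + t \<le> 1 then \<Psi> v (u + t) else \<Psi> (h v) (u + t - 1))"
  unfolding flow_def using assms end_eq by (subst glue_eq) auto

text \<open>If the flow stays on the edge, the parameter increases. If it passes to
  \<open>h v\<close>, the only danger is a loop \<open>h v = v\<close>, and then
  \<open>t < 1\<close> makes the new parameter \<open>u + t - 1\<close> smaller than
  \<open>u\<close>.\<close>

lemma flow_neq:
  assumes "x \<in> topspace X" "0 < t" "t < 1"
  shows "flow x t \<noteq> x"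
proof -
  obtain v u where v: "v \<in> V" "0 \<le> u" "u < 1" "x = \<Psi> v u"
    using assms exhaust by metis
  show ?thesis
  proof (cases "u + t < 1")
    case True
    then show ?thesis using flow_eq[of v u t] v assms inj[of v "u + t" v u] by auto
  next
    case False
    then have "flow x t = \<Psi> (h v) (u + t - 1)"
      using flow_eq[of v u t] v assms end_eq[of v] by (cases "u + t = 1") auto
    then show ?thesis using inj[of "h v" "u + t - 1" v u] v assms False h by auto
  qed
qed

text \<open>Joint continuity is checked on the squares of pairs \<open>(u, t)\<close>, one for each
  edge. Each square is cut along \<open>u + t = 1\<close>, where the two formulas agree by
  \<open>end_eq\<close>.\<close>

lemma continuous_map_flow:
  "continuous_map (prod_topology X unit_interval) X (\<lambda>(x, t). flow x t)"
proof (rule continuous_map_gluing[OF finite_V, where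
      K = "\<lambda>_. prod_topology unit_interval unit_interval" and g = "\<lambda>v (u, t). (\<Psi> v u, t)"])
  show "compact_space (prod_topology unit_interval unit_interval)"
    by (simp add: compact_space_prod_topology compact_space_subtopology
        del: prod_topology_subtopology_eu)
  show "Hausdorff_space (prod_topology X unit_interval)"
    by (simp add: Hausdorff_space_prod_topology Hausdorff Hausdorff_space_subtopology)
  show "topspace (prod_topology X unit_interval) \<subseteq>
    (\<Union>v\<in>V. (\<lambda>(u, t). (\<Psi> v u, t)) ` topspace (prod_topology unit_interval unit_interval))"
    by (force elim: exhaust)
  fix v assume v: "v \<in> V"
  show "continuous_map (prod_topology unit_interval unit_interval) (prod_topology X unit_interval)
    (\<lambda>(u, t). (\<Psi> v u, t))"
    using cont[OF v] by (simp add: continuous_map_prod_top del: prod_topology_subtopology_eu)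
  have sq: "prod_topology unit_interval unit_interval = top_of_set ({0..1} \<times> {0..1})"
    by simp
  have 1: "continuous_map (top_of_set {z \<in> {0..1} \<times> {0..1}. fst z + snd z \<le> 1}) X
      (\<lambda>z. \<Psi> v (fst z + snd z))"
    by (intro continuous_map_compose[OF _ cont[OF v], unfolded o_def])
      (auto intro!: continuous_intros)
  have 2: "continuous_map (top_of_set {z \<in> {0..1} \<times> {0..1}. 1 \<le> fst z + snd z}) X
      (\<lambda>z. \<Psi> (h v) (fst z + snd z - 1))"
    by (intro continuous_map_compose[OF _ cont[OF h[OF v]], unfolded o_def])
      (auto intro!: continuous_intros)
  have "continuous_map (top_of_set ({0..1} \<times> {0..1})) X
    (\<lambda>z. if fst z + snd z \<le> 1 then \<Psi> v (fst z + snd z) else \<Psi> (h v) (fst z + snd z - 1))"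
    using 1 2 end_eq[OF v]
    by (intro continuous_map_cases_le)
      (auto simp: subtopology_subtopology Int_def intro!: continuous_intros)
  then show "continuous_map (prod_topology unit_interval unit_interval) X
    (\<lambda>k. case case k of (u, t) \<Rightarrow> (\<Psi> v u, t) of (x, t) \<Rightarrow> flow x t)"
    unfolding sq by (rule continuous_map_eq) (use flow_eq v in auto)
qed

section \<open>A separation function that grows at most linearly along the flow\<close>

text \<open>On the edge \<open>w\<close> the pair \<open>tent w\<close>, \<open>skew_tent w\<close> determines the position, and
  \<open>vertex_coord w\<close> detects the vertex \<open>w\<close>.\<close>

definition tent :: "'v \<Rightarrow> 'a \<Rightarrow> real" where
  "tent w = glue (\<lambda>v u. of_bool (v = w) * min u (1 - u))"

definition skew_tent :: "'v \<Rightarrow> 'a \<Rightarrow> real" where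
  "skew_tent w = glue (\<lambda>v u. of_bool (v = w) * min u (2 * (1 - u)))"

definition vertex_coord :: "'v \<Rightarrow> 'a \<Rightarrow> real" where
  "vertex_coord w = glue (\<lambda>v u. of_bool (v = w) * (1 - u) + of_bool (h v = w) * u)"

text \<open>The l1 distance between the images of \<open>x\<close> and \<open>y\<close> in a real
  space with three coordinates per vertex. It serves as a metric on \<open>X\<close> explicit enough
  for Lipschitz estimates along the flow.\<close>

definition sep :: "'a \<Rightarrow> 'a \<Rightarrow> real" where
  "sep x y = (\<Sum>w\<in>V. \<bar>tent w x - tent w y\<bar> + \<bar>skew_tent w x - skew_tent w y\<bar> +
     \<bar>vertex_coord w x - vertex_coord w y\<bar>)"

lemma coord_eqs:
  assumes "v \<in> V" "u \<in> {0..1}"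
  shows "tent w (\<Psi> v u) = (if v = w then min u (1 - u) else 0)"
    and "skew_tent w (\<Psi> v u) = (if v = w then min u (2 * (1 - u)) else 0)"
    and "vertex_coord w (\<Psi> v u) = (if v = w then 1 - u else 0) + (if h v = w then u else 0)"
  unfolding tent_def skew_tent_def vertex_coord_def
  by (subst glue_eq; use assms in auto)+

lemma continuous_map_sep:
  "continuous_map (prod_topology X X) euclideanreal (\<lambda>(x, y). sep x y)"
proof -
  have 1: "continuous_map X euclideanreal (tent w)" for w
    unfolding tent_def by (rule continuous_map_glue) (auto intro!: continuous_intros)
  have 2: "continuous_map X euclideanreal (skew_tent w)" for w
    unfolding skew_tent_def by (rule continuous_map_glue) (auto intro!: continuous_intros)
  have 3: "continuous_map X euclideanreal (vertex_coord w)" for w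
    unfolding vertex_coord_def by (rule continuous_map_glue) (auto intro!: continuous_intros)
  show ?thesis
    unfolding sep_def case_prod_unfold
    by (intro continuous_intros finite_V
      continuous_map_compose[OF continuous_map_fst 1, unfolded o_def]
      continuous_map_compose[OF continuous_map_snd 1, unfolded o_def]
      continuous_map_compose[OF continuous_map_fst 2, unfolded o_def]
      continuous_map_compose[OF continuous_map_snd 2, unfolded o_def]
      continuous_map_compose[OF continuous_map_fst 3, unfolded o_def]
      continuous_map_compose[OF continuous_map_snd 3, unfolded o_def])
qed

lemma sep_nonneg: "0 \<le> sep x y"
  unfolding sep_def by (intro sum_nonneg) auto

lemma sep_pos:
  assumes "x \<in> topspace X" "y \<in> topspace X" "x \<noteq> y"
  shows "0 < sep x y"
proof (rule ccontr)
  assume "\<not> 0 < sep x y"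
  then have "sep x y = 0" using sep_nonneg[of x y] by simp
  then have all: "\<forall>w\<in>V. \<bar>tent w x - tent w y\<bar> + \<bar>skew_tent w x - skew_tent w y\<bar> +
      \<bar>vertex_coord w x - vertex_coord w y\<bar> = 0"
    unfolding sep_def by (subst (asm) sum_nonneg_eq_0_iff) (auto simp: finite_V)
  have eq: "tent w x = tent w y" "skew_tent w x = skew_tent w y"
    "vertex_coord w x = vertex_coord w y" if "w \<in> V" for w
    using all that by fastforce+
  obtain v u where v: "v \<in> V" "0 \<le> u" "u < 1" "x = \<Psi> v u"
    using assms exhaust by metis
  obtain v' u' where v': "v' \<in> V" "0 \<le> u'" "u' < 1" "y = \<Psi> v' u'"
    using assms exhaust by metis
  note ceq = coord_eqs[of v u] coord_eqs[of v' u']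
  have tents: "(if v = w then min u (1 - u) else 0) = (if v' = w then min u' (1 - u') else 0)"
    "(if v = w then min u (2 * (1 - u)) else 0) = (if v' = w then min u' (2 * (1 - u')) else 0)"
    "(if v = w then 1 - u else 0) + (if h v = w then u else 0) =
      (if v' = w then 1 - u' else 0) + (if h v' = w then u' else 0)"
    if "w \<in> V" for w
    using eq[OF that] ceq v v' by auto
  have "v = v' \<and> u = u'"
  proof (cases "v = v'")
    case True
    \<comment> \<open>Equal tents leave \<open>u' = u\<close> or \<open>u' = 1 - u\<close>. The skew
      tent rules out a proper reflection, and \<open>u, u' < 1\<close> rules out confusing the two
      ends.\<close>
    then show ?thesis using tents(1,2)[OF v(1)] v v' by (auto simp: min_def split: if_splits)
  next
    case False
    \<comment> \<open>On distinct edges both tents vanish, so both points are initial vertices;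
      \<open>vertex_coord v\<close> is 1 at the first and 0 at the second.\<close>
    then have "u = 0" "u' = 0"
      using tents(1)[OF v(1)] tents(1)[OF v'(1)] v v' by (auto simp: min_def split: if_splits)
    then show ?thesis using tents(3)[OF v(1)] False by auto
  qed
  then show False using v v' assms by simp
qed

text \<open>Elapsed time is change of edge parameter. If the path crosses a vertex, the values on
  the two edges match there by \<open>p v 1 = p (h v) 0\<close>, and the two bounds add up to
  \<open>L * t\<close>.\<close>

lemma glue_flow_le:
  fixes p :: "'v \<Rightarrow> real \<Rightarrow> real"
  assumes "x \<in> topspace X" "t \<in> {0..1}"
    and p: "\<And>v. v \<in> V \<Longrightarrow> p v 1 = p (h v) 0"
    and lip: "\<And>v u s. v \<in> V \<Longrightarrow> 0 \<le> u \<Longrightarrow> u \<le> s \<Longrightarrow> s \<le> 1 \<Longrightarrow> \<bar>p v s - p v u\<bar> \<le> L * (s - u)"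
  shows "\<bar>glue p (flow x t) - glue p x\<bar> \<le> L * t"
proof -
  obtain v u where v: "v \<in> V" "0 \<le> u" "u < 1" "x = \<Psi> v u"
    using assms exhaust by metis
  have gl: "glue p (\<Psi> w s) = p w s" if "w \<in> V" "s \<in> {0..1}" for w s
    using that p by (rule glue_eq)
  show ?thesis
  proof (cases "u + t \<le> 1")
    case True
    then show ?thesis using v assms(2) gl lip[of v u "u + t"] flow_eq[of v u t] by auto
  next
    case False
    have "\<bar>p v 1 - p v u\<bar> \<le> L * (1 - u)" using lip v by auto
    moreover have "\<bar>p (h v) (u + t - 1) - p (h v) 0\<bar> \<le> L * (u + t - 1 - 0)"
      using lip[of "h v" 0 "u + t - 1"] v h False assms(2) by auto
    moreover have "L * (1 - u) + L * (u + t - 1 - 0) = L * t" by (simp add: algebra_simps)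
    moreover have "glue p (flow x t) = p (h v) (u + t - 1)" "glue p x = p v u"
      using v assms(2) False flow_eq[of v u t] gl h by auto
    ultimately show ?thesis using p[OF v(1)] by linarith
  qed
qed

text \<open>Each of the three coordinate functions has Lipschitz constant at most 2 on every edge,
  which gives a factor 6 per vertex.\<close>

lemma sep_flow_le:
  assumes "x \<in> topspace X" "t \<in> {0..1}"
  shows "sep (flow x t) x \<le> 6 * real (card V) * t"
proof -
  have "\<bar>tent w (flow x t) - tent w x\<bar> \<le> 2 * t" for w
    unfolding tent_def by (rule glue_flow_le[OF assms]) (auto simp: min_def of_bool_def)
  moreover have "\<bar>skew_tent w (flow x t) - skew_tent w x\<bar> \<le> 2 * t" for w
    unfolding skew_tent_def by (rule glue_flow_le[OF assms]) (auto simp: min_def of_bool_def)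
  moreover have "\<bar>vertex_coord w (flow x t) - vertex_coord w x\<bar> \<le> 2 * t" for w
    unfolding vertex_coord_def by (rule glue_flow_le[OF assms]) (auto simp: of_bool_def)
  ultimately have "sep (flow x t) x \<le> of_nat (card V) * (2 * t + 2 * t + 2 * t)"
    unfolding sep_def by (intro sum_bounded_above add_mono)
  then show ?thesis by (simp add: algebra_simps)
qed

section \<open>Sections of the forgetful map\<close>

text \<open>Point 0 flows for a time that depends continuously on the configuration, so short that
  the \<open>sep\<close> it covers is less than the \<open>sep\<close> to every other point. As the
  time lies strictly between 0 and 1, the new point also differs from point 0.\<close>

lemma section_exists:
  assumes "V \<noteq> {}"
  shows "\<exists>s. continuous_map (conf_space n X) (conf_space (Suc n) X) s \<and>
    (\<forall>x\<in>topspace (conf_space n X). (forget_last n \<circ> s) x = x)"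
proof (cases "n = 0")
  case True
  \<comment> \<open>The empty configuration has no point to start from; a constant new point
    serves.\<close>
  obtain v where "v \<in> V" using assms by blast
  show ?thesis
    using True \<Psi>_in[OF \<open>v \<in> V\<close>, of 0] by (intro section_if_new_point[where f = "\<lambda>_. \<Psi> v 0"]) auto
next
  case False
  define K where "K = 6 * real (card V)"
  have "0 < K" using assms finite_V by (simp add: K_def card_gt_0_iff)
  \<comment> \<open>A product of factors in \<open>[0, 1]\<close> lies below each of them, so it can
    stand in for their minimum. Halving makes the later inequality strict and keeps the time below
    1; for \<open>n = 1\<close> the empty product gives time 1/2.\<close>
  define time where "time x = (\<Prod>j\<in>{1..<n}. min 1 (sep (x j) (x 0) / K)) / 2" for x
  have pos: "0 < sep (x j) (x 0)" if "x \<in> topspace (conf_space n X)" "j \<in> {1..<n}" for x j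
    using that False by (intro sep_pos) (auto simp: topspace_conf_space)
  have time: "0 < time x" "time x \<le> 1 / 2" if "x \<in> topspace (conf_space n X)" for x
    unfolding time_def using pos[OF that] \<open>0 < K\<close>
    by (auto intro!: prod_pos prod_le_1 simp: less_imp_le)
  have time_less: "K * time x < sep (x j) (x 0)"
    if x: "x \<in> topspace (conf_space n X)" and j: "j \<in> {1..<n}" for x j
  proof -
    have "(\<Prod>j\<in>{1..<n}. min 1 (sep (x j) (x 0) / K)) =
        min 1 (sep (x j) (x 0) / K) * (\<Prod>j\<in>{1..<n} - {j}. min 1 (sep (x j) (x 0) / K))"
      using j by (intro prod.remove) auto
    also have "\<dots> \<le> min 1 (sep (x j) (x 0) / K) * 1"
      using \<open>0 < K\<close> by (intro mult_left_mono prod_le_1) (auto simp: sep_nonneg)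
    finally have "time x \<le> sep (x j) (x 0) / K / 2" by (simp add: time_def)
    then show ?thesis using pos[OF x j] \<open>0 < K\<close> by (simp add: field_simps)
  qed
  have sep_cont: "continuous_map (conf_space n X) euclideanreal (\<lambda>x. sep (x j) (x 0))"
    if "j < n" for j
    using continuous_map_compose[OF _ continuous_map_sep, of "conf_space n X" "\<lambda>x. (x j, x 0)"]
      continuous_map_conf_proj[OF that, of X] continuous_map_conf_proj[of 0 n X] False
    by (simp add: o_def continuous_map_pairedI)
  have "continuous_map (conf_space n X) unit_interval time"
  proof (rule continuous_map_into_subtopology)
    show "continuous_map (conf_space n X) euclideanreal time"
      unfolding time_def using \<open>0 < K\<close>
      by (intro continuous_intros sep_cont) auto
    show "time \<in> topspace (conf_space n X) \<rightarrow> {0..1}"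
      using time by force
  qed
  then have "continuous_map (conf_space n X) X (\<lambda>x. flow (x 0) (time x))"
    using continuous_map_compose[OF _ continuous_map_flow, of "conf_space n X" "\<lambda>x. (x 0, time x)"]
      continuous_map_conf_proj[of 0 n X] False
    by (simp add: o_def continuous_map_pairedI)
  then show ?thesis
  proof (rule section_if_new_point)
    fix x i assume x: "x \<in> topspace (conf_space n X)" and i: "i < n"
    have x0: "x 0 \<in> topspace X" using x i by (auto simp: topspace_conf_space)
    show "flow (x 0) (time x) \<noteq> x i"
    proof (cases "i = 0")
      case True
      then show ?thesis using flow_neq[OF x0] time[OF x] by auto
    next
      case False
      \<comment> \<open>If the new point were \<open>x i\<close>, its \<open>sep\<close> from
        \<open>x 0\<close> would be at most \<open>K * time x\<close>, contrary to
        \<open>time_less\<close>.\<close>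
      then show ?thesis
        using time_less[OF x, of i] sep_flow_le[OF x0, of "time x"] time[OF x] i
        by (auto simp: K_def)
    qed
  qed
qed

end

section \<open>Graphs with vanishing Euler characteristic\<close>

text \<open>If no edge joined \<open>S\<close> to \<open>V - S\<close>, the subgraphs spanned by
  these two sets would be disjoint nonempty closed sets covering \<open>X\<close>, against
  connectedness.\<close>

lemma graph_complex_cut:
  assumes G: "graph_complex X V E \<Phi>" and S: "S \<subset> V" "S \<noteq> {}"
  shows "\<exists>e\<in>E. \<Phi> e 0 \<in> S \<and> \<Phi> e 1 \<in> V - S \<or> \<Phi> e 1 \<in> S \<and> \<Phi> e 0 \<in> V - S"
proof (rule ccontr)
  assume no: "\<not> ?thesis"
  note G' = G[unfolded graph_complex_def]
  \<comment> \<open>\<open>A W\<close> adds to \<open>W\<close> the closed edges that start in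
    \<open>W\<close>. Only the end at 0 is tested: for \<open>S\<close> and \<open>V - S\<close>,
    the negated claim puts the other end into the same set.\<close>
  define A where "A W = W \<union> (\<Union>e\<in>{e \<in> E. \<Phi> e 0 \<in> W}. \<Phi> e ` {0..1})" for W
  have ends: "\<Phi> e 0 \<in> V" "\<Phi> e 1 \<in> V" if "e \<in> E" for e using G' that by auto
  have I: "{0..1} = {0, 1} \<union> {0<..<1::real}" by auto
  have closed: "closedin X (A W)" if "W \<subseteq> V" for W
  proof -
    have "closedin X (\<Phi> e ` {0..1})" if "e \<in> E" for e
      using G' that closed_map_def closedin_topspace
      by (metis continuous_imp_closed_map compact_Icc compact_space_subtopology compactin_euclidean_iff
          topspace_euclidean_subtopology)
    moreover have "closedin X W"
      using G' that by (metis Hausdorff_imp_t1_space finite_subset le_supI1 t1_space_closedin_finite)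
    ultimately show ?thesis
      unfolding A_def using G' by (intro closedin_Un closedin_Union) auto
  qed
  have "topspace X \<subseteq> A S \<union> A (V - S)"
  proof
    fix x assume "x \<in> topspace X"
    then consider "x \<in> V" | e where "e \<in> E" "x \<in> \<Phi> e ` {0..1}"
      using G' unfolding I by blast
    then show "x \<in> A S \<union> A (V - S)"
    proof cases
      case 1
      then show ?thesis by (simp add: A_def)
    next
      case 2
      then show ?thesis using ends(1)[of e] unfolding A_def by blast
    qed
  qed
  moreover have "A S \<inter> A (V - S) = {}"
  proof -
    have 1: "\<Phi> e ` {0..1} \<inter> V \<subseteq> W" if "e \<in> E" "\<Phi> e 0 \<in> W" "W \<in> {S, V - S}" for e W
    proof -
      have "\<Phi> e 1 \<in> W" using no that ends[OF that(1)] by blast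
      moreover have "\<Phi> e ` {0<..<1} \<inter> V = {}" using G' that by blast
      ultimately show ?thesis using that(2) unfolding I by auto
    qed
    have 2: "\<Phi> e ` {0..1} \<inter> \<Phi> e' ` {0..1} \<subseteq> V" if "e \<in> E" "e' \<in> E" "e \<noteq> e'" for e e'
    proof -
      have "\<Phi> e ` {0<..<1} \<inter> \<Phi> e' ` {0<..<1} = {}"
        using G' that unfolding disjoint_family_on_def by blast
      then show ?thesis using ends that unfolding I by auto
    qed
    show ?thesis
    proof (rule ccontr)
      assume "A S \<inter> A (V - S) \<noteq> {}"
      then obtain x where x: "x \<in> A S" "x \<in> A (V - S)" by blast
      have inW: "x \<in> W" if W: "x \<in> V" "x \<in> A W" "W \<in> {S, V - S}" for W
      proof (rule ccontr)
        assume "x \<notin> W"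
        then obtain e where "e \<in> E" "\<Phi> e 0 \<in> W" "x \<in> \<Phi> e ` {0..1}"
          using W(2) unfolding A_def by auto
        then show False using 1[OF _ _ W(3), of e] W(1) \<open>x \<notin> W\<close> by blast
      qed
      \<comment> \<open>A common vertex would lie in both \<open>S\<close> and \<open>V - S\<close>.
        Any other common point lies on two closed edges, distinct because they start in different
        sets, and such edges meet only in vertices.\<close>
      have "x \<notin> V" using inW[OF _ x(1)] inW[OF _ x(2)] by auto
      then have "x \<notin> S" "x \<notin> V - S" using S by auto
      then obtain e e' where e: "e \<in> E" "\<Phi> e 0 \<in> S" "x \<in> \<Phi> e ` {0..1}"
        and e': "e' \<in> E" "\<Phi> e' 0 \<in> V - S" "x \<in> \<Phi> e' ` {0..1}"
        using x unfolding A_def by auto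
      then have "e \<noteq> e'" by auto
      then show False using 2[OF e(1) e'(1)] e(3) e'(3) \<open>x \<notin> V\<close> by blast
    qed
  qed
  moreover have "A S \<noteq> {}" "A (V - S) \<noteq> {}" using S unfolding A_def by auto
  moreover have "closedin X (A S)" "closedin X (A (V - S))" using closed S by auto
  moreover have "connected_space X" using G' by blast
  ultimately show False unfolding connected_space_closedin by metis
qed

text \<open>Euler characteristic zero means as many vertices as edges, so the bijection
  \<open>\<sigma>\<close> gives each vertex its own edge. Directed away from their vertices, these
  edges form the functional graph.\<close>

lemma graph_complex_functional_graph:
  assumes G: "graph_complex X V E \<Phi>" and "euler_char V E = 0"
  obtains h \<Psi> where "functional_graph X V h \<Psi>"
proof -
  note G' = G[unfolded graph_complex_def]
  have ends: "\<Phi> e 0 \<in> V" "\<Phi> e 1 \<in> V" if "e \<in> E" for e using G' that by auto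
  have card_eq: "card V = card E" using assms(2) by (simp add: euler_char_def)
  have X: "Hausdorff_space X" "finite V" using G' by blast+
  moreover have "V \<noteq> {}" using G' ends by auto
  ultimately obtain \<sigma> where \<sigma>: "bij_betw \<sigma> V E"
    "\<And>v. v \<in> V \<Longrightarrow> v = \<Phi> (\<sigma> v) 0 \<or> v = \<Phi> (\<sigma> v) 1"
    using card_eq outgoing_edge_bijection[where a = "\<lambda>e. \<Phi> e 0" and b = "\<lambda>e. \<Phi> e 1"]
      graph_complex_cut[OF G] ends by metis
  \<comment> \<open>The edge \<open>\<sigma> v\<close> is traversed backwards if \<open>v\<close> is
    not its start. For a loop the given direction is kept.\<close>
  define \<Psi> where "\<Psi> v u = (if v = \<Phi> (\<sigma> v) 0 then \<Phi> (\<sigma> v) u else \<Phi> (\<sigma> v) (1 - u))" for v u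
  have \<sigma>_in: "\<sigma> v \<in> E" if "v \<in> V" for v using \<sigma>(1) that by (auto simp: bij_betw_def)
  have \<Psi>_0: "\<Psi> v 0 = v" if "v \<in> V" for v using \<sigma>(2)[OF that] by (auto simp: \<Psi>_def)
  have \<Psi>_1: "\<Psi> v 1 \<in> V" if "v \<in> V" for v using ends \<sigma>_in that by (auto simp: \<Psi>_def)
  have \<Psi>_image: "\<Psi> v ` {0<..<1} = \<Phi> (\<sigma> v) ` {0<..<1}" for v
  proof -
    have "(\<lambda>u. 1 - u) ` {0<..<1} = {0<..<1::real}"
      by (force intro: image_eqI[where x = "1 - x" for x])
    then have "\<Phi> (\<sigma> v) ` {0<..<1} = (\<lambda>u. \<Phi> (\<sigma> v) (1 - u)) ` {0<..<1}"
      by (metis image_image)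
    then show ?thesis by (cases "v = \<Phi> (\<sigma> v) 0") (simp_all add: \<Psi>_def[abs_def])
  qed
  have \<Psi>_inj: "inj_on (\<Psi> v) {0<..<1}" if "v \<in> V" for v
  proof -
    have *: "inj_on (\<Phi> (\<sigma> v)) {0<..<1}" using G' \<sigma>_in[OF that] by blast
    show ?thesis
    proof (rule inj_onI)
      fix r s assume "r \<in> {0<..<1}" "s \<in> {0<..<1}" "\<Psi> v r = \<Psi> v s"
      then show "r = s"
        using inj_onD[OF *, of r s] inj_onD[OF *, of "1 - r" "1 - s"]
        by (auto simp: \<Psi>_def split: if_splits)
    qed
  qed
  have off: "\<Psi> v u \<notin> V" if "v \<in> V" "u \<in> {0<..<1}" for v u
  proof -
    have "\<Phi> (\<sigma> v) ` {0<..<1} \<inter> V = {}" using G' \<sigma>_in[OF that(1)] by blast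
    moreover have "\<Psi> v u \<in> \<Phi> (\<sigma> v) ` {0<..<1}" using \<Psi>_image[of v] that(2) by blast
    ultimately show ?thesis by blast
  qed
  have disj: "v = w" if "v \<in> V" "w \<in> V" "u \<in> {0<..<1}" "s \<in> {0<..<1}" "\<Psi> v u = \<Psi> w s" for v w u s
  proof -
    have "\<sigma> v = \<sigma> w"
    proof (rule ccontr)
      assume "\<sigma> v \<noteq> \<sigma> w"
      then have "\<Phi> (\<sigma> v) ` {0<..<1} \<inter> \<Phi> (\<sigma> w) ` {0<..<1} = {}"
        using G' \<sigma>_in[OF that(1)] \<sigma>_in[OF that(2)] unfolding disjoint_family_on_def by blast
      moreover have "\<Psi> v u \<in> \<Phi> (\<sigma> v) ` {0<..<1}" "\<Psi> w s \<in> \<Phi> (\<sigma> w) ` {0<..<1}"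
        using \<Psi>_image that(3,4) by blast+
      ultimately show False using that(5) by auto
    qed
    then show ?thesis using \<sigma>(1) that by (auto simp: bij_betw_def inj_on_def)
  qed
  \<comment> \<open>A half-open edge is a vertex together with an open 1-cell. The partition into
    half-open edges thus follows from the cell decomposition and the bijectivity of
    \<open>\<sigma>\<close>.\<close>
  have split: "{0..<1} = insert 0 {0<..<1::real}" by auto
  have "functional_graph X V (\<lambda>v. \<Psi> v 1) \<Psi>"
  proof
    show "continuous_map unit_interval X (\<Psi> v)" if "v \<in> V" for v
    proof -
      have c: "continuous_map unit_interval X (\<Phi> (\<sigma> v))" using G' \<sigma>_in[OF that] by blast
      have "continuous_map unit_interval X (\<lambda>u. \<Phi> (\<sigma> v) (1 - u))"
        by (intro continuous_map_compose[OF _ c, unfolded o_def]) (auto intro!: continuous_intros)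
      then show ?thesis using c by (cases "v = \<Phi> (\<sigma> v) 0") (simp_all add: \<Psi>_def[abs_def])
    qed
    have "inj_on (\<lambda>(v, u). \<Psi> v u) (V \<times> {0..<1})"
    proof (rule inj_onI, clarify)
      fix v u w s
      assume A: "v \<in> V" "w \<in> V" "u \<in> {0..<1}" "s \<in> {0..<1::real}" "\<Psi> v u = \<Psi> w s"
      consider "u = 0" "s = 0" | "u = 0" "s \<in> {0<..<1}" | "u \<in> {0<..<1}" "s = 0"
        | "u \<in> {0<..<1}" "s \<in> {0<..<1}"
        using A unfolding split by blast
      then show "v = w \<and> u = s"
      proof cases
        case 1
        then show ?thesis using A \<Psi>_0 by simp
      next
        case 2
        then show ?thesis using A \<Psi>_0[of v] off[of w s] by simp
      next
        case 3
        then show ?thesis using A \<Psi>_0[of w] off[of v u] by simp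
      next
        case 4
        then show ?thesis using disj A \<Psi>_inj by (metis inj_onD)
      qed
    qed
    moreover have "(\<lambda>(v, u). \<Psi> v u) ` (V \<times> {0..<1}) = topspace X"
    proof -
      have "(\<lambda>(v, u). \<Psi> v u) ` (V \<times> {0..<1}) = (\<Union>v\<in>V. \<Psi> v ` {0..<1})" by force
      also have "\<dots> = V \<union> (\<Union>v\<in>V. \<Psi> v ` {0<..<1})"
        unfolding split using \<Psi>_0 by auto
      also have "(\<Union>v\<in>V. \<Psi> v ` {0<..<1}) = (\<Union>e\<in>\<sigma> ` V. \<Phi> e ` {0<..<1})"
        using \<Psi>_image by simp
      also have "\<sigma> ` V = E" using \<sigma>(1) by (simp add: bij_betw_def)
      finally show ?thesis using G' by simp
    qed
    ultimately show "bij_betw (\<lambda>(v, u). \<Psi> v u) (V \<times> {0..<1}) (topspace X)"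
      by (simp add: bij_betw_def)
  qed (simp_all add: X \<Psi>_0 \<Psi>_1)
  then show ?thesis using that by blast
qed

theorem theorem1p2:
  fixes X :: "'a topology" and V :: "'a set" and E :: "'e set" and \<Phi> :: "'e \<Rightarrow> real \<Rightarrow> 'a"
  assumes "graph_complex X V E \<Phi>"
    and "euler_char V E = 0"
  shows "\<forall>n::nat. \<exists>s. continuous_map (conf_space n X) (conf_space (Suc n) X) s \<and>
           (\<forall>x\<in>topspace (conf_space n X). (forget_last n \<circ> s) x = x)"
proof -
  obtain h \<Psi> where "functional_graph X V h \<Psi>"
    using graph_complex_functional_graph[OF assms] .
  then interpret functional_graph X V h \<Psi> .
  have "V \<noteq> {}" using assms(1) unfolding graph_complex_def by auto
  then show ?thesis using section_exists by blast
qed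

end
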